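(* Let $d \ge 1$, let $a_1, \dots, a_d$ be nonnegative integers, and let $\mathcal{F} = \{(A_i^{(1)}, \dots, A_i^{(d)}) \mid i \in [m]\}$ be a skew Bollobás system of $d$-tuples of finite sets such that $|A_i^{(p)}| = a_p$ for all $i \in [m]$ and $p \in [d]$. Then $$m \le \binom{a_1 + \cdots + a_d}{a_1, \dots, a_d}.$$
   Context: $\binom{a_1+\cdots+a_d}{a_1,\dots,a_d} = \frac{(a_1+\cdots+a_d)!}{a_1!\cdots a_d!}$ is the multinomial coefficient. A family $\mathcal{F} = \{(A_i^{(1)}, \dots, A_i^{(d)}) \mid i \in [m]\}$ of $d$-tuples of finite sets is a skew Bollobás system of $d$-tuples if $A_i^{(p)} \cap A_i^{(q)} = \emptyset$ for every $i \in [m]$ and $p \ne q$, and for any $i < j$ in $[m]$ there exist $p < q$ in $[d]$ with $A_i^{(p)} \cap A_j^{(q)} \ne \emptyset$. *)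

theory Defs
  imports Complex_Main
begin

text \<open>
  The division is exact, see \<open>multinomial_mult_prod_fact\<close> below. The parts
  are \<open>a p\<close> for \<open>p\<close> in \<open>{1..d}\<close>; other values of \<open>a\<close> are irrelevant.
\<close>

definition multinomial :: "nat \<Rightarrow> (nat \<Rightarrow> nat) \<Rightarrow> nat" where
  "multinomial d a = fact (\<Sum>p = 1..d. a p) div (\<Prod>p = 1..d. fact (a p))"

lemma prod_fact_dvd_fact_sum:
  fixes d :: nat and a :: "nat \<Rightarrow> nat"
  shows "(\<Prod>p = 1..d. fact (a p)) dvd (fact (\<Sum>p = 1..d. a p) :: nat)"
proof (induction d)
  case 0
  show ?case by simp
next
  case (Suc d)
  have "(\<Prod>p = 1..Suc d. fact (a p)) dvd (fact (\<Sum>p = 1..d. a p) * fact (a (Suc d)) :: nat)"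
    using Suc.IH by (simp add: mult_dvd_mono)
  also have "\<dots> dvd fact (\<Sum>p = 1..Suc d. a p)"
    by (simp add: fact_fact_dvd_fact)
  finally show ?case .
qed

lemma multinomial_mult_prod_fact:
  "multinomial d a * (\<Prod>p = 1..d. fact (a p)) = fact (\<Sum>p = 1..d. a p)"
  unfolding multinomial_def using prod_fact_dvd_fact_sum by (rule dvd_div_mult_self)

text \<open>
  \<open>A i p\<close> is the \<open>p\<close>-th component of the \<open>i\<close>-th tuple; only indices \<open>i\<close> in
  \<open>{1..m}\<close> and \<open>p\<close> in \<open>{1..d}\<close> matter. Finiteness of the components is part of
  the definition and is not implied by cardinality conditions, since
  \<open>card\<close> is 0 on infinite sets.
\<close>

definition skew_bollobas_system ::
    "nat \<Rightarrow> nat \<Rightarrow> (nat \<Rightarrow> nat \<Rightarrow> 'a set) \<Rightarrow> bool" where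
  "skew_bollobas_system d m A \<longleftrightarrow>
     (\<forall>i\<in>{1..m}. \<forall>p\<in>{1..d}. finite (A i p)) \<and>
     (\<forall>i\<in>{1..m}. \<forall>p\<in>{1..d}. \<forall>q\<in>{1..d}. p \<noteq> q \<longrightarrow> A i p \<inter> A i q = {}) \<and>
     (\<forall>i\<in>{1..m}. \<forall>j\<in>{1..m}. i < j \<longrightarrow>
        (\<exists>p\<in>{1..d}. \<exists>q\<in>{1..d}. p < q \<and> A i p \<inter> A j q \<noteq> {}))"

end

theory Submission
  imports Defs "HOL-Library.FuncSet" "HOL-Computational_Algebra.Polynomial"
begin

text \<open>
  Embed the ground set into the reals and let \<open>M i j\<close> be the product of the
  differences \<open>y - x\<close> over all \<open>p < q\<close>, \<open>x\<close> in \<open>A i p\<close> and \<open>y\<close> in \<open>A j q\<close>.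
  The hypotheses say that this matrix is triangular with nonzero diagonal, so its rank is \<open>m\<close>.
  On the other hand, the factor of \<open>M i j\<close> that belongs to \<open>q\<close> is the product over \<open>y\<close> in \<open>A j q\<close> of
  a polynomial in \<open>y\<close> of degree \<open>s = a 1 + \<dots> + a (q - 1)\<close> which depends only on \<open>i\<close>. It is
  therefore a form of degree \<open>a q\<close> in the \<open>s + 1\<close> coefficients of this polynomial, which
  bounds the rank of the factor by \<open>(s + a q) choose a q\<close>; the product of these
  numbers over \<open>q\<close> is the multinomial coefficient.
\<close>

text \<open>Gaussian elimination, by induction on the set of equations: one equation is used to
  remove one unknown.\<close>

lemma homogeneous_system_nontrivial_solution:
  fixes c :: "'j \<Rightarrow> 'k \<Rightarrow> 'f::field"
  assumes "finite K" "finite J" "card K < card J"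
  shows "\<exists>v. (\<exists>j\<in>J. v j \<noteq> 0) \<and> (\<forall>k\<in>K. (\<Sum>j\<in>J. v j * c j k) = 0)"
  using assms
proof (induction K arbitrary: J c rule: finite_induct)
  case empty
  then obtain j where "j \<in> J" by fastforce
  then show ?case by (intro exI[of _ "\<lambda>_. 1"]) auto
next
  case (insert k K)
  show ?case
  proof (cases "\<forall>j\<in>J. c j k = 0")
    case True
    obtain v where "\<exists>j\<in>J. v j \<noteq> 0" "\<forall>l\<in>K. (\<Sum>j\<in>J. v j * c j l) = 0"
      using insert.IH[of J c] insert.prems insert.hyps by auto
    with True show ?thesis by (intro exI[of _ v]) auto
  next
    case False
    then obtain j0 where j0: "j0 \<in> J" "c j0 k \<noteq> 0" by blast
    define r where "r j = c j k / c j0 k" for j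
    let ?J = "J - {j0}"
    have "card K < card ?J"
      using insert.prems insert.hyps j0 by (simp add: card_Diff_singleton)
    then obtain v where v: "\<exists>j\<in>?J. v j \<noteq> 0"
        "\<forall>l\<in>K. (\<Sum>j\<in>?J. v j * (c j l - r j * c j0 l)) = 0"
      using insert.IH[of ?J "\<lambda>j l. c j l - r j * c j0 l"] insert.prems by auto
    \<comment> \<open>Equation \<open>k\<close> forces this value at \<open>j0\<close>. Substituting
      it turns every equation into its reduced form, and the reduced form of \<open>k\<close> has
      only zero coefficients.\<close>
    define v' where "v' = v(j0 := - (\<Sum>j\<in>?J. v j * r j))"
    have sum_v': "(\<Sum>j\<in>J. v' j * c j l) = (\<Sum>j\<in>?J. v j * (c j l - r j * c j0 l))" for l
    proof -
      have "(\<Sum>j\<in>J. v' j * c j l) = v' j0 * c j0 l + (\<Sum>j\<in>?J. v' j * c j l)"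
        using j0 insert.prems by (intro sum.remove) auto
      also have "(\<Sum>j\<in>?J. v' j * c j l) = (\<Sum>j\<in>?J. v j * c j l)"
        by (intro sum.cong) (auto simp: v'_def)
      finally show ?thesis
        by (simp add: v'_def sum_distrib_right sum_subtractf right_diff_distrib mult.assoc)
    qed
    have "(\<Sum>j\<in>J. v' j * c j l) = 0" if "l \<in> insert k K" for l
      using that v(2) j0(2) unfolding sum_v' by (auto simp: r_def)
    moreover have "\<exists>j\<in>J. v' j \<noteq> 0"
      using v(1) by (auto simp: v'_def)
    ultimately show ?thesis by blast
  qed
qed

text \<open>The matrix of these sums factors through \<open>K\<close>, so its rank is at most
  \<open>card K\<close>, while triangularity gives it full rank \<open>card I\<close>.\<close>

lemma triangular_matrix_card_le:
  fixes g h :: "'i::linorder \<Rightarrow> 'k \<Rightarrow> 'f::field"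
  assumes "finite K" "finite I"
    and diag: "\<And>i. i \<in> I \<Longrightarrow> (\<Sum>k\<in>K. g i k * h i k) \<noteq> 0"
    and upper: "\<And>i j. i \<in> I \<Longrightarrow> j \<in> I \<Longrightarrow> i < j \<Longrightarrow> (\<Sum>k\<in>K. g i k * h j k) = 0"
  shows "card I \<le> card K"
proof (rule ccontr)
  assume "\<not> card I \<le> card K"
  then obtain v where v: "\<exists>j\<in>I. v j \<noteq> 0" "\<forall>k\<in>K. (\<Sum>j\<in>I. v j * h j k) = 0"
    using homogeneous_system_nontrivial_solution[of K I h] assms(1,2) by auto
  \<comment> \<open>Pairing the vanishing combination with \<open>g i\<close> for the least index in
    the support of \<open>v\<close> isolates the diagonal term: \<open>v\<close> kills the smaller
    indices and \<open>upper\<close> the larger ones.\<close>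
  define i where "i = Min {j\<in>I. v j \<noteq> 0}"
  have i: "i \<in> I" "v i \<noteq> 0"
    using Min_in[of "{j\<in>I. v j \<noteq> 0}"] v(1) assms(2) unfolding i_def by auto
  have below: "v j = 0" if "j \<in> I" "j < i" for j
    using Min_le[of "{j\<in>I. v j \<noteq> 0}" j] that assms(2) unfolding i_def by fastforce
  have "0 = (\<Sum>k\<in>K. g i k * (\<Sum>j\<in>I. v j * h j k))"
    using v(2) by simp
  also have "\<dots> = (\<Sum>j\<in>I. v j * (\<Sum>k\<in>K. g i k * h j k))"
    unfolding sum_distrib_left by (subst sum.swap) (simp add: mult_ac)
  also have "\<dots> = (\<Sum>j\<in>I. if j = i then v i * (\<Sum>k\<in>K. g i k * h i k) else 0)"
  proof (intro sum.cong refl)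
    fix j assume "j \<in> I"
    then show "v j * (\<Sum>k\<in>K. g i k * h j k)
        = (if j = i then v i * (\<Sum>k\<in>K. g i k * h i k) else 0)"
      using below[of j] upper[of i j] i(1) by (cases j i rule: linorder_cases) auto
  qed
  also have "\<dots> = v i * (\<Sum>k\<in>K. g i k * h i k)"
    using i(1) assms(2) by simp
  finally show False
    using i diag by auto
qed

text \<open>
  The list \<open>l\<close> is the exponent vector of a monomial in \<open>c 0, \<dots>, c n\<close>; what matters is
  that the cofactors \<open>h l\<close> do not depend on \<open>c\<close>.
\<close>

lemma prod_of_linear_forms_expansion:
  fixes w :: "'b \<Rightarrow> nat \<Rightarrow> 'f::comm_semiring_1"
  assumes "finite B"
  shows "\<exists>h. \<forall>c. (\<Prod>y\<in>B. \<Sum>k\<le>n. c k * w y k) =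
    (\<Sum>l | length l = Suc n \<and> sum_list l = card B. (\<Prod>k\<le>n. c k ^ (l ! k)) * h l)"
proof -
  \<comment> \<open>Multiplying out picks one index \<open>f y\<close> from each factor. The choices
    \<open>f\<close> with equal \<open>expo f\<close> give the same monomial in \<open>c\<close>,
    and \<open>h\<close> collects their weights.\<close>
  define F where "F = (B \<rightarrow>\<^sub>E {..n})"
  define L where "L = {l :: nat list. length l = Suc n \<and> sum_list l = card B}"
  define expo where "expo f = map (\<lambda>k. card {y\<in>B. f y = k}) [0..<Suc n]" for f :: "'b \<Rightarrow> nat"
  define h where "h l = (\<Sum>f\<in>{f\<in>F. expo f = l}. \<Prod>y\<in>B. w y (f y))" for l
  have finF: "finite F"
    unfolding F_def using assms by (intro finite_PiE) auto
  have finL: "finite L"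
  proof (rule finite_subset)
    show "L \<subseteq> {l. set l \<subseteq> {..card B} \<and> length l = Suc n}"
      unfolding L_def using member_le_sum_list by force
  qed (simp add: finite_lists_length_eq)
  have expo_L: "expo ` F \<subseteq> L"
  proof
    fix l assume "l \<in> expo ` F"
    then obtain f where f: "f \<in> F" "l = expo f" by blast
    have "sum_list (expo f) = (\<Sum>k\<le>n. card {y\<in>B. f y = k})"
      by (simp only: expo_def interv_sum_list_conv_sum_set_nat set_upt
          atLeast0LessThan lessThan_Suc_atMost)
    also have "\<dots> = (\<Sum>y\<in>B. 1)"
      using sum.group[of B "{..n}" f "\<lambda>_. 1::nat"] f(1) assms by (auto simp: F_def)
    finally show "l \<in> L"
      using f(2) by (simp add: L_def expo_def del: upt_Suc)
  qed
  have "(\<Prod>y\<in>B. \<Sum>k\<le>n. c k * w y k) = (\<Sum>l\<in>L. (\<Prod>k\<le>n. c k ^ (l ! k)) * h l)" for c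
  proof -
    have mono: "(\<Prod>y\<in>B. c (f y)) = (\<Prod>k\<le>n. c k ^ (expo f ! k))" if "f \<in> F" for f
    proof -
      have "f ` B \<subseteq> {..n}"
        using that by (auto simp: F_def)
      then have "(\<Prod>y\<in>B. c (f y)) = (\<Prod>k\<le>n. \<Prod>y\<in>{y\<in>B. f y = k}. c (f y))"
        using prod.group[of B "{..n}" f "\<lambda>y. c (f y)"] assms by simp
      also have "\<dots> = (\<Prod>k\<le>n. c k ^ (expo f ! k))"
        by (intro prod.cong) (auto simp: expo_def simp del: upt_Suc)
      finally show ?thesis .
    qed
    have "(\<Prod>y\<in>B. \<Sum>k\<le>n. c k * w y k) = (\<Sum>f\<in>F. \<Prod>y\<in>B. c (f y) * w y (f y))"
      unfolding F_def using assms by (intro prod_sum_PiE) auto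
    also have "\<dots> = (\<Sum>f\<in>F. (\<Prod>k\<le>n. c k ^ (expo f ! k)) * (\<Prod>y\<in>B. w y (f y)))"
      by (intro sum.cong) (auto simp: prod.distrib mono)
    also have "\<dots> = (\<Sum>l\<in>L. \<Sum>f\<in>{f\<in>F. expo f = l}.
        (\<Prod>k\<le>n. c k ^ (expo f ! k)) * (\<Prod>y\<in>B. w y (f y)))"
      by (rule sum.group[OF finF finL expo_L, symmetric])
    also have "\<dots> = (\<Sum>l\<in>L. (\<Prod>k\<le>n. c k ^ (l ! k)) * h l)"
      unfolding h_def sum_distrib_left by (intro sum.cong refl) auto
    finally show ?thesis .
  qed
  then show ?thesis unfolding L_def by blast
qed

lemma card_lists_length_Suc_sum_list:
  "card {l :: nat list. length l = Suc n \<and> sum_list l = b} = (n + b) choose b"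
  using card_length_sum_list[of "Suc n" b] by (simp add: add.commute)

text \<open>The product is a polynomial in \<open>y\<close> with roots \<open>e x\<close>; its
  coefficients depend on \<open>S\<close> alone.\<close>

lemma prod_differences_expansion:
  fixes e :: "'b \<Rightarrow> 'f::idom"
  assumes "finite S"
  shows "\<exists>c. \<forall>y. (\<Prod>x\<in>S. y - e x) = (\<Sum>k\<le>card S. c k * y ^ k)"
proof -
  define P where "P = (\<Prod>x\<in>S. [:- e x, 1:])"
  have "degree P = card S"
    unfolding P_def by (subst degree_prod_eq_sum_degree) auto
  moreover have "poly P y = (\<Prod>x\<in>S. y - e x)" for y
    by (simp add: P_def poly_prod)
  ultimately show ?thesis
    by (metis poly_altdef)
qed

text \<open>The factorials of the partial sums telescope. In this form each factor counts the
  monomials available for one \<open>q\<close>.\<close>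

lemma multinomial_eq_prod_binomial:
  "multinomial d a = (\<Prod>q = 1..d. ((\<Sum>p = 1..<q. a p) + a q) choose a q)"
proof -
  have "(\<Prod>q = 1..d. ((\<Sum>p = 1..<q. a p) + a q) choose a q) * (\<Prod>p = 1..d. fact (a p))
      = (fact (\<Sum>p = 1..d. a p) :: nat)"
  proof (induction d)
    case (Suc d)
    have "fact ((\<Sum>p = 1..d. a p) + a (Suc d)) =
        (((\<Sum>p = 1..d. a p) + a (Suc d)) choose a (Suc d)) * fact (a (Suc d)) * fact (\<Sum>p = 1..d. a p)"
      using binomial_fact_lemma[of "a (Suc d)" "(\<Sum>p = 1..d. a p) + a (Suc d)"]
      by (simp add: mult_ac)
    with Suc.IH show ?case
      by (simp add: atLeastLessThanSuc_atLeastAtMost mult_ac flip: Suc.IH)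
  qed simp
  also have "\<dots> = multinomial d a * (\<Prod>p = 1..d. fact (a p))"
    by (rule multinomial_mult_prod_fact[symmetric])
  finally show ?thesis
    by simp
qed

theorem theorem1p9:
  fixes d m :: nat and a :: "nat \<Rightarrow> nat" and A :: "nat \<Rightarrow> nat \<Rightarrow> 'a set"
  assumes "d \<ge> 1"
    and "skew_bollobas_system d m A"
    and "\<And>i p. i \<in> {1..m} \<Longrightarrow> p \<in> {1..d} \<Longrightarrow> card (A i p) = a p"
  shows "m \<le> multinomial d a"
proof -
  have fin: "finite (A i p)" if "i \<in> {1..m}" "p \<in> {1..d}" for i p
    using assms(2) that unfolding skew_bollobas_system_def by blast
  have disj: "A i p \<inter> A i q = {}" if "i \<in> {1..m}" "p \<in> {1..d}" "q \<in> {1..d}" "p \<noteq> q" for i p q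
    using assms(2) that unfolding skew_bollobas_system_def by blast
  have skew: "\<exists>p\<in>{1..d}. \<exists>q\<in>{1..d}. p < q \<and> A i p \<inter> A j q \<noteq> {}"
    if "i \<in> {1..m}" "j \<in> {1..m}" "i < j" for i j
    using assms(2) that unfolding skew_bollobas_system_def by blast

  \<comment> \<open>The type \<open>'a\<close> may be too large to embed into the reals, but only
    this finite set has to be embedded.\<close>
  define X where "X = (\<Union>i\<in>{1..m}. \<Union>p\<in>{1..d}. A i p)"
  have "finite X" unfolding X_def using fin by blast
  then obtain e0 :: "'a \<Rightarrow> nat" where "inj_on e0 X"
    using finite_imp_inj_to_nat_seg by blast
  then have inj: "inj_on (\<lambda>x. real (e0 x)) X"
    by (auto simp: inj_on_def)
  define e where "e x = real (e0 x)" for x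
  have e_eq: "e x = e y \<longleftrightarrow> x = y" if "x \<in> X" "y \<in> X" for x y
    using inj that by (auto simp: inj_on_def e_def)

  define S where "S i q = (\<Union>p\<in>{1..<q}. A i p)" for i q
  define s where "s q = (\<Sum>p = 1..<q. a p)" for q
  have finS: "finite (S i q)" if "i \<in> {1..m}" "q \<in> {1..d}" for i q
    unfolding S_def using that fin by auto
  have cardS: "card (S i q) = s q" if "i \<in> {1..m}" "q \<in> {1..d}" for i q
  proof -
    have "card (S i q) = (\<Sum>p = 1..<q. card (A i p))"
      unfolding S_def using that fin disj by (intro card_UN_disjoint) auto
    also have "\<dots> = s q"
      unfolding s_def using that assms(3) by (intro sum.cong) auto
    finally show ?thesis .
  qed

  define M where "M i j = (\<Prod>q\<in>{1..d}. \<Prod>y\<in>A j q. \<Prod>x\<in>S i q. e y - e x)" for i j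
  have M_diag: "M i i \<noteq> 0" if i: "i \<in> {1..m}" for i
  proof -
    have "e y - e x \<noteq> 0" if "q \<in> {1..d}" "y \<in> A i q" "x \<in> S i q" for q x y
    proof -
      obtain p where p: "p \<in> {1..<q}" "x \<in> A i p"
        using \<open>x \<in> S i q\<close> by (auto simp: S_def)
      then have "p \<in> {1..d}" "p \<noteq> q" using that by auto
      then have "x \<noteq> y" "x \<in> X" "y \<in> X"
        using disj[of i p q] i p that by (auto simp: X_def)
      then show ?thesis using e_eq by auto
    qed
    then show ?thesis
      unfolding M_def using i fin finS by simp
  qed
  have M_upper: "M i j = 0" if ij: "i \<in> {1..m}" "j \<in> {1..m}" "i < j" for i j
  proof -
    obtain p q x where *: "p \<in> {1..d}" "q \<in> {1..d}" "p < q" "x \<in> A i p" "x \<in> A j q"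
      using skew[OF ij] by blast
    \<comment> \<open>The common element \<open>x\<close> occurs on both sides of a difference,
      which contributes the factor \<open>e x - e x\<close>.\<close>
    then have "x \<in> S i q" by (auto simp: S_def)
    then have "(\<Prod>z\<in>S i q. e x - e z) = 0"
      using finS ij * by (subst prod_zero_iff) auto
    then have "(\<Prod>y\<in>A j q. \<Prod>z\<in>S i q. e y - e z) = 0"
      using fin ij * by (subst prod_zero_iff) auto
    then show ?thesis
      unfolding M_def using * by (subst prod_zero_iff) auto
  qed

  define L where "L q = {l :: nat list. length l = Suc (s q) \<and> sum_list l = a q}" for q
  define c where
    "c i q = (SOME c. \<forall>y. (\<Prod>x\<in>S i q. y - e x) = (\<Sum>k\<le>s q. c k * y ^ k))" for i q
  have c: "(\<Prod>x\<in>S i q. y - e x) = (\<Sum>k\<le>s q. c i q k * y ^ k)"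
    if "i \<in> {1..m}" "q \<in> {1..d}" for i q y
  proof -
    have "\<exists>c. \<forall>y. (\<Prod>x\<in>S i q. y - e x) = (\<Sum>k\<le>s q. c k * y ^ k)"
      using prod_differences_expansion[OF finS[OF that], of e] unfolding cardS[OF that] .
    from someI_ex[OF this] show ?thesis
      unfolding c_def by blast
  qed
  \<comment> \<open>The choice is made uniformly in \<open>c\<close>, so \<open>h j q\<close> does
    not depend on \<open>i\<close>; this separates the roles of \<open>i\<close> and
    \<open>j\<close>.\<close>
  define h where
    "h j q = (SOME h. \<forall>c. (\<Prod>y\<in>A j q. \<Sum>k\<le>s q. c k * e y ^ k)
      = (\<Sum>l\<in>L q. (\<Prod>k\<le>s q. c k ^ (l ! k)) * h l))" for j q
  have h: "(\<Prod>y\<in>A j q. \<Sum>k\<le>s q. c k * e y ^ k)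
      = (\<Sum>l\<in>L q. (\<Prod>k\<le>s q. c k ^ (l ! k)) * h j q l)"
    if "j \<in> {1..m}" "q \<in> {1..d}" for j q c
  proof -
    have "\<exists>h. \<forall>c. (\<Prod>y\<in>A j q. \<Sum>k\<le>s q. c k * e y ^ k)
        = (\<Sum>l\<in>L q. (\<Prod>k\<le>s q. c k ^ (l ! k)) * h l)"
      using prod_of_linear_forms_expansion[OF fin[OF that], where n = "s q" and w = "\<lambda>y k. e y ^ k"]
      unfolding L_def assms(3)[OF that] .
    from someI_ex[OF this] show ?thesis
      unfolding h_def by blast
  qed

  have card_L: "card (L q) = (s q + a q) choose a q" for q
    unfolding L_def by (rule card_lists_length_Suc_sum_list)
  \<comment> \<open>The binomial coefficient is positive, whereas an infinite set would have
    \<open>card\<close> 0.\<close>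
  have fin_L: "finite (L q)" for q
    by (rule card_ge_0_finite) (simp add: card_L)
  \<comment> \<open>One exponent list for each \<open>q\<close>: distributing the product over
    \<open>q\<close> across the sums over \<open>L q\<close> makes these families the common index
    set of \<open>G\<close> and \<open>H\<close>.\<close>
  define K where "K = Pi\<^sub>E {1..d} L"
  define G where "G i f = (\<Prod>q\<in>{1..d}. \<Prod>k\<le>s q. c i q k ^ (f q ! k))" for i f
  define H where "H j f = (\<Prod>q\<in>{1..d}. h j q (f q))" for j f
  have M_factor: "(\<Sum>f\<in>K. G i f * H j f) = M i j" if "i \<in> {1..m}" "j \<in> {1..m}" for i j
  proof -
    have "M i j = (\<Prod>q\<in>{1..d}. \<Sum>l\<in>L q. (\<Prod>k\<le>s q. c i q k ^ (l ! k)) * h j q l)"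
      unfolding M_def using that by (intro prod.cong) (simp_all add: c h)
    also have "\<dots> = (\<Sum>f\<in>K. \<Prod>q\<in>{1..d}. (\<Prod>k\<le>s q. c i q k ^ (f q ! k)) * h j q (f q))"
      unfolding K_def using fin_L by (intro prod_sum_PiE) auto
    also have "\<dots> = (\<Sum>f\<in>K. G i f * H j f)"
      by (simp add: G_def H_def prod.distrib)
    finally show ?thesis ..
  qed
  have "finite K"
    unfolding K_def using fin_L by (intro finite_PiE) auto
  then have "card {1..m} \<le> card K"
    by (rule triangular_matrix_card_le[where g = G and h = H])
      (use M_diag M_upper in \<open>simp_all add: M_factor\<close>)
  also have "card K = multinomial d a"
    by (simp add: K_def card_PiE card_L multinomial_eq_prod_binomial s_def)
  finally show ?thesis by simp
qed

end
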